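(* Let $0<q<1$, $a>0$, $0<\alpha<1$, let $p,r,w_\alpha$ be real-valued functions on $A_{q,a}^*$ with $p(x)\neq0$ and $w_\alpha(x)>0$ for all $x\in A_{q,a}^*$, and let $c_1,c_2,d_1,d_2$ be real with $c_1^2+c_2^2\ne0$, $d_1^2+d_2^2\neq0$. Then all eigenvalues of the regular $q$-fractional Sturm--Liouville problem $$D_{q,a^-}^{\alpha}\big(p\,{}^cD_{q,0^+}^{\alpha}y\big)(x)+r(x)y(x)-\lambda w_\alpha(x)y(x)=0,\quad x\in A_{q,a}^*,$$ $$c_1y(0)+c_2\big[I_{q,a^-}^{1-\alpha}\,p\,{}^cD_{q,0^+}^{\alpha}y\big](0)=0,\qquad d_1y(a)+d_2\big[I_{q,a^-}^{1-\alpha}\,p\,{}^cD_{q,0^+}^{\alpha}y\big]\left(\tfrac aq\right)=0$$ are real.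
   Context: Notation: $A_{q,a}=\{aq^n:n\in\mathbb{N}_0\}$, $A_{q,a}^*=A_{q,a}\cup\{0\}$; $(z;q)_\infty=\prod_{k\ge 0}(1-zq^k)$; $(z;q)_\nu=(z;q)_\infty/(zq^{\nu};q)_\infty$; $\Gamma_q(\nu)=\frac{(q;q)_\infty}{(q^\nu;q)_\infty}(1-q)^{1-\nu}$. Jackson integral: $\int_0^x f(t)\,d_qt=(1-q)\sum_{n\ge 0}xq^nf(xq^n)$, $\int_c^d=\int_0^d-\int_0^c$. $D_qf(x)=\frac{f(x)-f(qx)}{(1-q)x}$, $D_{q^{-1}}f(x)=\frac{f(x)-f(x/q)}{(1-q^{-1})x}$ for $x\neq0$ (values at $0$ are limits along $A_{q,a}$). $f$ is $q$-regular at zero if $\lim_{n\to\infty}f(xq^n)=f(0)$ for all $x\in A_{q,a}^*$. Operators: $$I_{q,0^+}^{\nu}f(x)=\frac{x^{\nu-1}}{\Gamma_q(\nu)}\int_0^x(qt/x;q)_{\nu-1}f(t)\,d_qt,\qquad I_{q,a^-}^{\nu}f(x)=\frac{1}{\Gamma_q(\nu)}\int_{qx}^{a}t^{\nu-1}(qx/t;q)_{\nu-1}f(t)\,d_qt,$$ $${}^cD_{q,0^+}^\alpha f=I_{q,0^+}^{1-\alpha}D_qf,\qquad D_{q,a^-}^\alpha f=-\tfrac1qD_{q^{-1}}I_{q,a^-}^{1-\alpha}f .$$ $[h](a/q)$ denotes the value of $h$ at $x=a/q$. A complex number $\lambda$ is an eigenvalue if the boundary value problem has a non-trivial solution $y$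 (an eigenfunction); solutions are sought among (complex-valued) functions in $L_q^2(A_{q,a}^* )$ (i.e. $\int_0^a|y|^2d_qu<\infty$) which are $q$-regular at zero. *)

theory Defs
  imports "HOL-Analysis.Analysis"
begin

definition q_lattice :: "real \<Rightarrow> real \<Rightarrow> real set" where
  "q_lattice q a = {a * q ^ n | n. True}"

definition q_lattice0 :: "real \<Rightarrow> real \<Rightarrow> real set" where
  "q_lattice0 q a = q_lattice q a \<union> {0}"

definition qpoch_inf :: "real \<Rightarrow> real \<Rightarrow> real" where
  "qpoch_inf z q = (\<Prod>k. 1 - z * q ^ k)"

definition qpoch :: "real \<Rightarrow> real \<Rightarrow> real \<Rightarrow> real" where
  "qpoch z q \<nu> = qpoch_inf z q / qpoch_inf (z * q powr \<nu>) q"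

definition q_Gamma :: "real \<Rightarrow> real \<Rightarrow> real" where
  "q_Gamma q \<nu> = qpoch_inf q q / qpoch_inf (q powr \<nu>) q * (1 - q) powr (1 - \<nu>)"

definition jackson_integrable0 :: "real \<Rightarrow> real \<Rightarrow> (real \<Rightarrow> 'a::real_normed_vector) \<Rightarrow> bool" where
  "jackson_integrable0 q x f \<longleftrightarrow> summable (\<lambda>n. (x * q ^ n) *\<^sub>R f (x * q ^ n))"

definition jackson_integral0 :: "real \<Rightarrow> real \<Rightarrow> (real \<Rightarrow> 'a::real_normed_vector) \<Rightarrow> 'a" where
  "jackson_integral0 q x f = (1 - q) *\<^sub>R (\<Sum>n. (x * q ^ n) *\<^sub>R f (x * q ^ n))"

definition jackson_integral :: "real \<Rightarrow> real \<Rightarrow> real \<Rightarrow> (real \<Rightarrow> 'a::real_normed_vector) \<Rightarrow> 'a" where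
  "jackson_integral q c d f = jackson_integral0 q d f - jackson_integral0 q c f"

definition q_deriv_quot :: "real \<Rightarrow> (real \<Rightarrow> complex) \<Rightarrow> real \<Rightarrow> complex" where
  "q_deriv_quot q f x = (f x - f (q * x)) / of_real ((1 - q) * x)"

text \<open>The value at \<open>0\<close> of each of the two q-derivatives is the limit along the lattice.
  It is meaningful only when that limit exists; for the operator occurring in the equation this
  is demanded separately in \<open>q_sl_solution\<close>.\<close>

definition q_deriv :: "real \<Rightarrow> real \<Rightarrow> (real \<Rightarrow> complex) \<Rightarrow> real \<Rightarrow> complex" where
  "q_deriv q a f x =
     (if x = 0 then lim (\<lambda>n. q_deriv_quot q f (a * q ^ n)) else q_deriv_quot q f x)"

definition q_inv_deriv :: "real \<Rightarrow> real \<Rightarrow> (real \<Rightarrow> complex) \<Rightarrow> real \<Rightarrow> complex" where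
  "q_inv_deriv q a f x =
     (if x = 0 then lim (\<lambda>n. q_deriv_quot (1 / q) f (a * q ^ n)) else q_deriv_quot (1 / q) f x)"

definition q_regular_at_zero :: "real \<Rightarrow> real \<Rightarrow> (real \<Rightarrow> complex) \<Rightarrow> bool" where
  "q_regular_at_zero q a f \<longleftrightarrow> (\<forall>x\<in>q_lattice0 q a. (\<lambda>n. f (x * q ^ n)) \<longlonglongrightarrow> f 0)"

definition q_L2 :: "real \<Rightarrow> real \<Rightarrow> (real \<Rightarrow> complex) set" where
  "q_L2 q a = {f. jackson_integrable0 q a (\<lambda>u. (cmod (f u))\<^sup>2)}"

text \<open>At \<open>x = 0\<close> the following expression is \<open>0\<close> by the convention \<open>0 powr s = 0\<close>. That value never
  enters the boundary value problem: Jackson integrals up to the endpoints \<open>a\<close> and \<open>q * x\<close>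
  sample their integrand at lattice points only (at \<open>0\<close> just with coefficient \<open>0\<close>).\<close>

definition q_frac_int_left :: "real \<Rightarrow> real \<Rightarrow> (real \<Rightarrow> complex) \<Rightarrow> real \<Rightarrow> complex" where
  "q_frac_int_left q \<nu> f x =
     of_real (x powr (\<nu> - 1) / q_Gamma q \<nu>) *
     jackson_integral q 0 x (\<lambda>t. of_real (qpoch (q * t / x) q (\<nu> - 1)) * f t)"

text \<open>At \<open>x = 0\<close> the kernel is \<open>t powr (\<nu> - 1)\<close>, since \<open>qpoch 0 q (\<nu> - 1) = 1\<close>.\<close>

definition q_frac_int_right :: "real \<Rightarrow> real \<Rightarrow> real \<Rightarrow> (real \<Rightarrow> complex) \<Rightarrow> real \<Rightarrow> complex" where
  "q_frac_int_right q a \<nu> f x =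
     of_real (1 / q_Gamma q \<nu>) *
     jackson_integral q (q * x) a
       (\<lambda>t. of_real (t powr (\<nu> - 1) * qpoch (q * x / t) q (\<nu> - 1)) * f t)"

definition q_caputo_left :: "real \<Rightarrow> real \<Rightarrow> real \<Rightarrow> (real \<Rightarrow> complex) \<Rightarrow> real \<Rightarrow> complex" where
  "q_caputo_left q a \<alpha> f = q_frac_int_left q (1 - \<alpha>) (q_deriv q a f)"

definition q_rl_right :: "real \<Rightarrow> real \<Rightarrow> real \<Rightarrow> (real \<Rightarrow> complex) \<Rightarrow> real \<Rightarrow> complex" where
  "q_rl_right q a \<alpha> f x = - of_real (1 / q) * q_inv_deriv q a (q_frac_int_right q a (1 - \<alpha>) f) x"

definition q_sl_flux ::
  "real \<Rightarrow> real \<Rightarrow> real \<Rightarrow> (real \<Rightarrow> real) \<Rightarrow> (real \<Rightarrow> complex) \<Rightarrow> real \<Rightarrow> complex" where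
  "q_sl_flux q a \<alpha> p y x = of_real (p x) * q_caputo_left q a \<alpha> y x"

text \<open>The convergence clause says that the fractional derivative exists at \<open>0\<close>, so that the
  equation at \<open>x = 0\<close>, a point of \<open>q_lattice0 q a\<close>, is meaningful. Functions are total on the reals,
  but only the values of \<open>p\<close>, \<open>r\<close>, \<open>w\<close>, \<open>y\<close> on \<open>q_lattice0 q a\<close> are used.\<close>

definition q_sl_solution ::
  "real \<Rightarrow> real \<Rightarrow> real \<Rightarrow> (real \<Rightarrow> real) \<Rightarrow> (real \<Rightarrow> real) \<Rightarrow> (real \<Rightarrow> real) \<Rightarrow>
   real \<Rightarrow> real \<Rightarrow> real \<Rightarrow> real \<Rightarrow> complex \<Rightarrow> (real \<Rightarrow> complex) \<Rightarrow> bool" where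
  "q_sl_solution q a \<alpha> p r w c1 c2 d1 d2 ev y \<longleftrightarrow>
     y \<in> q_L2 q a \<and> q_regular_at_zero q a y \<and>
     convergent (\<lambda>n. q_rl_right q a \<alpha> (q_sl_flux q a \<alpha> p y) (a * q ^ n)) \<and>
     (\<forall>x\<in>q_lattice0 q a.
        q_rl_right q a \<alpha> (q_sl_flux q a \<alpha> p y) x + of_real (r x) * y x
          - ev * of_real (w x) * y x = 0) \<and>
     of_real c1 * y 0
       + of_real c2 * q_frac_int_right q a (1 - \<alpha>) (q_sl_flux q a \<alpha> p y) 0 = 0 \<and>
     of_real d1 * y a
       + of_real d2 * q_frac_int_right q a (1 - \<alpha>) (q_sl_flux q a \<alpha> p y) (a / q) = 0"

definition q_sl_eigenvalue ::
  "real \<Rightarrow> real \<Rightarrow> real \<Rightarrow> (real \<Rightarrow> real) \<Rightarrow> (real \<Rightarrow> real) \<Rightarrow> (real \<Rightarrow> real) \<Rightarrow>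
   real \<Rightarrow> real \<Rightarrow> real \<Rightarrow> real \<Rightarrow> complex \<Rightarrow> bool" where
  "q_sl_eigenvalue q a \<alpha> p r w c1 c2 d1 d2 ev \<longleftrightarrow>
     (\<exists>y. q_sl_solution q a \<alpha> p r w c1 c2 d1 d2 ev y \<and> (\<exists>x\<in>q_lattice0 q a. y x \<noteq> 0))"

end

theory Submission
  imports Defs
begin

text \<open>
  The eigenvalues are real because the operator is symmetric with respect to the Jackson integral:
  multiply the equation by \<open>cnj y\<close>, sum over the lattice and take imaginary parts. Since \<open>r\<close> and
  \<open>w\<close> are real, what remains is \<open>Im ev\<close> times a sum of nonnegative terms on one side, and on the
  other the imaginary part of the fractional operator paired with \<open>y\<close>. The latter vanishes, as
  fractional integration by parts shows. The point that needs care is convergence, as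
  \<open>p\<close>, \<open>r\<close> and \<open>w\<close> may be unbounded near \<open>0\<close>.

  Put \<open>x n = a * q ^ n\<close> and let \<open>\<kappa> k\<close> be the fractional kernel \<open>q_kernel\<close>, which decreases to \<open>1\<close>.
  On the lattice the right fractional integral of the flux at \<open>x m\<close> is, up to a constant, the
  convolution \<open>G m = (\<Sum>n\<le>m. \<kappa> (m - n) * s n)\<close>, where \<open>s n\<close> is the flux at \<open>x n\<close> times \<open>x n powr \<nu>\<close>
  with \<open>\<nu> = 1 - \<alpha>\<close>. The right derivative at \<open>x m\<close> is, again up to a
  constant, the backward difference of \<open>G\<close> divided by \<open>x m\<close>. The
  Caputo derivative of \<open>y\<close> at \<open>x n\<close> is a real multiple of
  \<open>T n = (\<Sum>k. \<kappa> k * (y (x (n + k)) - y (x (n + k + 1))))\<close>.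

  As the right derivative converges along the lattice, the backward differences of \<open>G\<close> are
  \<open>O(q ^ n)\<close>. They form the convolution of \<open>s\<close> with the backward difference of \<open>\<kappa>\<close>, which has a
  positive first entry, no positive entry after that, and total \<open>1\<close>; this makes \<open>s\<close> absolutely
  summable (\<open>abs_summable_of_convolution\<close>). So the order of summation may be changed
  (\<open>convolution_pairing_sums\<close>), and a summation by parts turns the pairing of the backward
  differences of \<open>G\<close> with \<open>cnj y\<close> into
  \<open>(\<Sum>n. s n * cnj (T n)) + (\<Sum>n. s n) * cnj (y 0)\<close> (\<open>convolution_duality\<close>). In the first sum every
  term is a real number times \<open>(cmod (T n))\<^sup>2\<close>. In the second, \<open>\<Sum>n. s n\<close> is a real multiple of the right
  fractional integral of the flux at \<open>0\<close>, so that the boundary condition at \<open>0\<close> makes the product with \<open>cnj (y 0)\<close> real. There is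
  no contribution from the other end, since the right fractional integral vanishes at \<open>a / q\<close>.
\<close>

section \<open>Sequences under a backward difference\<close>

text \<open>Taking the entry before the first to be \<open>0\<close> makes this the inverse of forming partial sums, and
  compatible with convolution. It also fits the right fractional integral, whose value at \<open>a / q\<close>,
  one step before the first lattice point, is \<open>0\<close>.\<close>

definition backward_diff :: "(nat \<Rightarrow> 'a::ab_group_add) \<Rightarrow> nat \<Rightarrow> 'a" where
  "backward_diff f n = f n - (if n = 0 then 0 else f (n - 1))"

lemma backward_diff_0 [simp]: "backward_diff f 0 = f 0"
  by (simp add: backward_diff_def)

lemma backward_diff_Suc [simp]: "backward_diff f (Suc n) = f (Suc n) - f n"
  by (simp add: backward_diff_def)

lemma sum_backward_diff: "(\<Sum>k\<le>n. backward_diff f k) = f n"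
  by (induction n) auto

lemma backward_diff_abs_summable:
  fixes f :: "nat \<Rightarrow> real"
  assumes "decseq f" and "f \<longlonglongrightarrow> l"
  shows "summable (\<lambda>k. \<bar>backward_diff f k\<bar>)"
proof -
  have "summable (\<lambda>k. f k - f (Suc k))"
    using telescope_summable'[OF assms(2)] .
  moreover have "\<bar>backward_diff f (Suc k)\<bar> = f k - f (Suc k)" for k
    using decseq_SucD[OF assms(1), of k] by simp
  ultimately show ?thesis
    by (subst summable_Suc_iff[symmetric]) simp
qed

lemma backward_diff_convolution:
  fixes \<kappa> :: "nat \<Rightarrow> 'a::comm_ring"
  shows "backward_diff (\<lambda>m. \<Sum>n\<le>m. \<kappa> (m - n) * s n) m = (\<Sum>n\<le>m. backward_diff \<kappa> (m - n) * s n)"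
proof (cases m)
  case (Suc j)
  have "(\<Sum>n\<le>j. \<kappa> (Suc j - n) * s n) - (\<Sum>n\<le>j. \<kappa> (j - n) * s n)
      = (\<Sum>n\<le>j. backward_diff \<kappa> (Suc j - n) * s n)"
    unfolding sum_subtractf[symmetric]
    by (intro sum.cong refl) (simp add: Suc_diff_le algebra_simps)
  then show ?thesis by (simp add: Suc algebra_simps)
qed simp

lemma summation_by_parts:
  fixes \<kappa> z :: "nat \<Rightarrow> 'a::comm_ring"
  shows "(\<Sum>k\<le>n. backward_diff \<kappa> k * z k) = (\<Sum>k<n. \<kappa> k * (z k - z (Suc k))) + \<kappa> n * z n"
  by (induction n) (simp_all add: algebra_simps)

lemma summation_by_parts_sums:
  fixes \<kappa> z :: "nat \<Rightarrow> complex"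
  assumes "summable (\<lambda>k. backward_diff \<kappa> k * z k)" and "\<kappa> \<longlonglongrightarrow> l" and "z \<longlonglongrightarrow> \<zeta>"
  shows "(\<lambda>k. \<kappa> k * (z k - z (Suc k))) sums ((\<Sum>k. backward_diff \<kappa> k * z k) - l * \<zeta>)"
proof -
  have "(\<lambda>n. (\<Sum>k\<le>n. backward_diff \<kappa> k * z k) - \<kappa> n * z n)
      \<longlonglongrightarrow> (\<Sum>k. backward_diff \<kappa> k * z k) - l * \<zeta>"
    using assms by (intro tendsto_intros summable_LIMSEQ')
  then show ?thesis
    by (simp add: sums_def summation_by_parts)
qed

lemma sum_convolution_swap:
  fixes f :: "nat \<Rightarrow> nat \<Rightarrow> 'a::comm_monoid_add"
  shows "(\<Sum>m<N. \<Sum>n\<le>m. f n (m - n)) = (\<Sum>n<N. \<Sum>k<N - n. f n k)"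
proof -
  have "{(n, k). n + k < N} = Sigma {..<N} (\<lambda>n. {..<N - n})" by auto
  then show ?thesis
    by (simp add: sum.triangle_reindex[symmetric] sum.Sigma)
qed

text \<open>With \<open>m = n + k\<close> the left side is the double series of \<open>\<delta> k * s n * z (n + k)\<close>, summed along
  the diagonals. It is dominated by \<open>norm (\<delta> k) * norm (s n)\<close>, so summing by rows gives the same
  value. The partial sums over the triangle \<open>n + k < N\<close> are handled by Tannery's theorem, with
  dominating terms \<open>norm (s n) * M\<close>.\<close>

lemma convolution_pairing_sums:
  fixes \<delta> s z :: "nat \<Rightarrow> complex"
  assumes \<delta>: "summable (\<lambda>k. norm (\<delta> k))" and s: "summable (\<lambda>n. norm (s n))"
    and z: "Bseq z"
  shows "summable (\<lambda>n. s n * (\<Sum>k. \<delta> k * z (n + k)))"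
    and "(\<lambda>m. (\<Sum>n\<le>m. \<delta> (m - n) * s n) * z m) sums (\<Sum>n. s n * (\<Sum>k. \<delta> k * z (n + k)))"
proof -
  obtain B where B: "\<And>n. norm (z n) \<le> B" and "B > 0"
    using z by (auto simp: Bseq_def)
  have bound: "norm (\<delta> k * z (n + k)) \<le> norm (\<delta> k) * B" for n k
    by (simp add: norm_mult B mult_left_mono)
  have \<delta>B: "summable (\<lambda>k. norm (\<delta> k) * B)"
    using \<delta> by (rule summable_mult2)
  have inner: "summable (\<lambda>k. \<delta> k * z (n + k))" for n
    using bound by (intro summable_comparison_test'[OF \<delta>B]) auto
  define M where "M = (\<Sum>k. norm (\<delta> k) * B)"
  have partial: "norm (\<Sum>k<j. \<delta> k * z (n + k)) \<le> M" for n j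
  proof -
    have "norm (\<Sum>k<j. \<delta> k * z (n + k)) \<le> (\<Sum>k<j. norm (\<delta> k) * B)"
      using bound by (intro sum_norm_le) auto
    also have "\<dots> \<le> M"
      unfolding M_def using \<delta>B \<open>B > 0\<close> by (intro sum_le_suminf) auto
    finally show ?thesis .
  qed
  have "M \<ge> 0" using partial[of 0 0] by simp
  define g where "g n N = (if n < N then s n * (\<Sum>k<N - n. \<delta> k * z (n + k)) else 0)" for n N
  \<comment> \<open>\<open>g n N\<close> is the part of row \<open>n\<close> that lies in the triangle \<open>n + k < N\<close>.\<close>
  have g_lim: "(\<lambda>N. g n N) \<longlonglongrightarrow> s n * (\<Sum>k. \<delta> k * z (n + k))" for n
  proof (rule LIMSEQ_offset[where k = "Suc n"])
    have "(\<lambda>N. s n * (\<Sum>k<Suc N. \<delta> k * z (n + k))) \<longlonglongrightarrow> s n * (\<Sum>k. \<delta> k * z (n + k))"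
      using LIMSEQ_Suc[OF summable_LIMSEQ[OF inner[of n]]] by (intro tendsto_intros)
    moreover have "g n (N + Suc n) = s n * (\<Sum>k<Suc N. \<delta> k * z (n + k))" for N
      by (simp add: g_def del: sum.lessThan_Suc)
    ultimately show "(\<lambda>N. g n (N + Suc n)) \<longlonglongrightarrow> s n * (\<Sum>k. \<delta> k * z (n + k))"
      by simp
  qed
  have g_le: "norm (g n N) \<le> norm (s n) * M" for n N
    using partial \<open>M \<ge> 0\<close> by (auto simp: g_def norm_mult intro!: mult_left_mono)
  have tannery: "summable (\<lambda>n. norm (s n * (\<Sum>k. \<delta> k * z (n + k)))) \<and>
      ((\<lambda>N. \<Sum>n. g n N) \<longlonglongrightarrow> (\<Sum>n. s n * (\<Sum>k. \<delta> k * z (n + k))))"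
    by (rule tannerys_theorem[where M = "\<lambda>n. norm (s n) * M", THEN conjunct2])
       (use g_lim g_le s in \<open>auto intro!: summable_mult2 always_eventually\<close>)
  then show "summable (\<lambda>n. s n * (\<Sum>k. \<delta> k * z (n + k)))"
    by (blast intro: summable_norm_cancel)
  note tannery[THEN conjunct2]
  moreover have "(\<Sum>n. g n N) = (\<Sum>m<N. (\<Sum>n\<le>m. \<delta> (m - n) * s n) * z m)" for N
  proof -
    have "(\<Sum>n. g n N) = (\<Sum>n<N. g n N)"
      by (rule suminf_finite) (auto simp: g_def)
    also have "\<dots> = (\<Sum>n<N. \<Sum>k<N - n. s n * (\<delta> k * z (n + k)))"
      by (simp add: g_def sum_distrib_left)
    also have "\<dots> = (\<Sum>m<N. \<Sum>n\<le>m. s n * (\<delta> (m - n) * z (n + (m - n))))"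
      by (rule sum_convolution_swap[symmetric])
    also have "\<dots> = (\<Sum>m<N. (\<Sum>n\<le>m. \<delta> (m - n) * s n) * z m)"
      unfolding sum_distrib_right by (intro sum.cong refl) (simp add: mult_ac)
    finally show ?thesis .
  qed
  ultimately show "(\<lambda>m. (\<Sum>n\<le>m. \<delta> (m - n) * s n) * z m) sums (\<Sum>n. s n * (\<Sum>k. \<delta> k * z (n + k)))"
    by (simp add: sums_def)
qed

text \<open>A quantitative inverse to convolution with a decreasing kernel. With \<open>\<delta>\<close> the backward difference
  of \<open>\<kappa>\<close>, the sequence \<open>\<delta> * s\<close> is summable by assumption. Only \<open>\<delta> 0\<close> is positive, so solving for
  \<open>\<delta> 0 * s m\<close> and taking norms shows that \<open>\<delta> * norm s\<close> lies pointwise below the norm of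
  \<open>\<delta> * s\<close>. The sum of \<open>\<delta> * norm s\<close> over the first \<open>N\<close> indices gives the weight
  \<open>\<kappa> (N - n - 1) \<ge> l\<close> to each \<open>norm (s n)\<close>, hence \<open>l * (\<Sum>n<N. norm (s n))\<close> stays bounded.\<close>

lemma abs_summable_of_convolution:
  fixes \<kappa> :: "nat \<Rightarrow> real" and s :: "nat \<Rightarrow> complex"
  assumes dec: "decseq \<kappa>" and lim: "\<kappa> \<longlonglongrightarrow> l" and "l > 0"
    and conv: "summable (\<lambda>m. norm (backward_diff (\<lambda>m. \<Sum>n\<le>m. of_real (\<kappa> (m - n)) * s n) m))"
  shows "summable (\<lambda>n. norm (s n))"
proof -
  define G where "G m = (\<Sum>n\<le>m. of_real (\<kappa> (m - n)) * s n)" for m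
  define \<delta> where "\<delta> = backward_diff \<kappa>"
  have \<delta>_neg: "\<delta> (Suc k) \<le> 0" for k
    using decseq_SucD[OF dec, of k] by (simp add: \<delta>_def)
  have \<kappa>_ge: "\<kappa> k \<ge> l" for k
    using decseq_ge[OF dec lim] .
  have pointwise: "(\<Sum>n\<le>m. \<delta> (m - n) * norm (s n)) \<le> norm (backward_diff G m)" for m
  proof -
    have "backward_diff G m = (\<Sum>n\<le>m. of_real (\<delta> (m - n)) * s n)"
      unfolding G_def backward_diff_convolution[where \<kappa> = "\<lambda>k. of_real (\<kappa> k)"] \<delta>_def
      by (intro sum.cong refl) (simp add: backward_diff_def)
    also have "\<dots> = of_real (\<kappa> 0) * s m + (\<Sum>n<m. of_real (\<delta> (m - n)) * s n)"
      by (simp add: lessThan_Suc_atMost[symmetric] \<delta>_def)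
    finally have *: "backward_diff G m - (\<Sum>n<m. of_real (\<delta> (m - n)) * s n) = of_real (\<kappa> 0) * s m"
      by simp
    have "\<kappa> 0 * norm (s m) = norm (backward_diff G m - (\<Sum>n<m. of_real (\<delta> (m - n)) * s n))"
      using \<kappa>_ge[of 0] \<open>l > 0\<close> by (simp add: * norm_mult)
    also have "\<dots> \<le> norm (backward_diff G m) + (\<Sum>n<m. norm (of_real (\<delta> (m - n)) * s n))"
      by (rule order_trans[OF norm_triangle_ineq4]) (simp add: norm_sum)
    also have "(\<Sum>n<m. norm (of_real (\<delta> (m - n)) * s n)) = - (\<Sum>n<m. \<delta> (m - n) * norm (s n))"
      unfolding sum_negf[symmetric]
    proof (intro sum.cong refl)
      fix n assume "n \<in> {..<m}"
      then have "m - n = Suc (m - Suc n)" by auto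
      then show "norm (of_real (\<delta> (m - n)) * s n) = - (\<delta> (m - n) * norm (s n))"
        using \<delta>_neg[of "m - Suc n"] by (simp add: norm_mult)
    qed
    finally show ?thesis
      by (simp add: lessThan_Suc_atMost[symmetric] \<delta>_def)
  qed
  have "(\<Sum>n<N. norm (s n)) \<le> (\<Sum>m. norm (backward_diff G m)) / l" for N
  proof -
    have "(\<Sum>n<N. l * norm (s n)) \<le> (\<Sum>n<N. \<Sum>k<N - n. \<delta> k * norm (s n))"
    proof (rule sum_mono)
      fix n assume "n \<in> {..<N}"
      then have "{..<N - n} = {..N - Suc n}" by auto
      then have "(\<Sum>k<N - n. \<delta> k) = \<kappa> (N - Suc n)"
        by (simp add: \<delta>_def sum_backward_diff)
      then show "l * norm (s n) \<le> (\<Sum>k<N - n. \<delta> k * norm (s n))"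
        using \<kappa>_ge by (simp add: sum_distrib_right[symmetric] mult_right_mono)
    qed
    also have "\<dots> = (\<Sum>m<N. \<Sum>n\<le>m. \<delta> (m - n) * norm (s n))"
      by (rule sum_convolution_swap[symmetric])
    also have "\<dots> \<le> (\<Sum>m<N. norm (backward_diff G m))"
      by (intro sum_mono pointwise)
    also have "\<dots> \<le> (\<Sum>m. norm (backward_diff G m))"
      using conv by (intro sum_le_suminf) (auto simp: G_def[abs_def])
    finally show ?thesis
      using \<open>l > 0\<close> by (simp add: sum_distrib_left[symmetric] field_simps)
  qed
  then show ?thesis
    by (intro summableI_nonneg_bounded) auto
qed

section \<open>The fractional kernel on the lattice\<close>

lemma qpoch_inf_convergent_prod:
  assumes "0 < q" "q < 1"
  shows "convergent_prod (\<lambda>k. 1 - z * q ^ k :: real)"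
proof -
  have "summable (\<lambda>k. \<bar>z\<bar> * q ^ k)"
    using assms by (intro summable_mult summable_geometric) auto
  then have "summable (\<lambda>k. norm (1 - z * q ^ k - 1))"
    using assms by (simp add: abs_mult)
  then show ?thesis
    using abs_convergent_prod_conv_summable abs_convergent_prod_imp_convergent_prod by blast
qed

lemma qpoch_inf_factor_pos:
  fixes q z :: real
  assumes "0 < q" "q < 1" "z < 1"
  shows "0 < 1 - z * q ^ k"
proof (cases "z > 0")
  case True
  have "z * q ^ k \<le> z * 1"
    using assms True by (intro mult_left_mono power_le_one) auto
  with assms show ?thesis by simp
next
  case False
  then have "z * q ^ k \<le> 0"
    using assms by (intro mult_nonpos_nonneg) auto
  then show ?thesis by simp
qed

lemma qpoch_inf_pos:
  assumes "0 < q" "q < 1" "z < 1"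
  shows "qpoch_inf z q > 0"
  unfolding qpoch_inf_def
  using assms by (intro less_0_prodinf qpoch_inf_convergent_prod qpoch_inf_factor_pos)

lemma qpoch_inf_Suc:
  assumes "0 < q" "q < 1" "z < 1"
  shows "qpoch_inf z q = (1 - z) * qpoch_inf (q * z) q"
  using prodinf_split_head[OF qpoch_inf_convergent_prod[OF assms(1,2), of z]] assms
  by (simp add: qpoch_inf_def mult_ac field_simps)

lemma qpoch_inf_tendsto_1:
  assumes "0 < q" "q < 1" "z < 1"
  shows "(\<lambda>n. qpoch_inf (z * q ^ n) q) \<longlonglongrightarrow> 1"
proof -
  let ?f = "\<lambda>k. 1 - z * q ^ k"
  have conv: "convergent_prod ?f"
    using assms by (intro qpoch_inf_convergent_prod)
  have nz: "?f k \<noteq> 0" for k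
    using qpoch_inf_factor_pos[OF assms, of k] by simp
  have P: "prodinf ?f \<noteq> 0"
    by (rule prodinf_nonzero[OF conv nz])
  have "(\<lambda>n. \<Prod>k<n. ?f k) \<longlonglongrightarrow> prodinf ?f"
    using convergent_prod_LIMSEQ[OF conv] LIMSEQ_lessThan_iff_atMost[of "\<lambda>A. prod ?f A"] by simp
  then have "(\<lambda>n. prodinf ?f / (\<Prod>k<n. ?f k)) \<longlonglongrightarrow> prodinf ?f / prodinf ?f"
    using P by (intro tendsto_intros)
  moreover have "qpoch_inf (z * q ^ n) q = prodinf ?f / (\<Prod>k<n. ?f k)" for n
    using prodinf_divide_initial_segment[OF conv nz, of n]
    by (simp add: qpoch_inf_def power_add mult_ac)
  ultimately show ?thesis using P by simp
qed

text \<open>This vanishing at \<open>z = q\<close> to a nonpositive power cuts off the right fractional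
  integral: at \<open>x m\<close> only the lattice points \<open>x n\<close> with \<open>n \<le> m\<close> contribute.\<close>

lemma qpoch_inf_eq_0:
  assumes "0 < q" "q < 1" "z * q ^ k = 1"
  shows "qpoch_inf z q = 0"
  unfolding qpoch_inf_def
  by (rule has_prod_zeroI[OF convergent_prod_has_prod[OF qpoch_inf_convergent_prod[OF assms(1,2)]], of _ k])
     (simp add: assms)

lemma qpoch_0:
  "qpoch 0 q \<nu> = 1"
  by (simp add: qpoch_def qpoch_inf_def)

text \<open>The kernel of both fractional integrals of order \<open>\<nu>\<close> between two lattice points that are \<open>k\<close>
  steps apart.\<close>

definition q_kernel :: "real \<Rightarrow> real \<Rightarrow> nat \<Rightarrow> real" where
  "q_kernel q \<nu> k = qpoch (q ^ Suc k) q (\<nu> - 1)"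

context
  fixes q \<nu> :: real
  assumes q: "0 < q" "q < 1" and \<nu>: "0 < \<nu>" "\<nu> < 1"
begin

lemma q_kernel_altdef:
  "q_kernel q \<nu> k = qpoch_inf (q * q ^ k) q / qpoch_inf (q powr \<nu> * q ^ k) q"
  using q by (simp add: q_kernel_def qpoch_def powr_diff mult.commute)

lemma q_powr_bounds: "q < q powr \<nu>" "q powr \<nu> < 1"
proof -
  show "q < q powr \<nu>"
    using powr_less_mono'[of q \<nu> 1] q \<nu> by simp
  show "q powr \<nu> < 1"
    using powr_less_mono'[of q 0 \<nu>] q \<nu> by simp
qed

lemma q_powr_power_less_1: "q powr \<nu> * q ^ k < 1"
  using qpoch_inf_factor_pos[OF q q_powr_bounds(2), of k] by simp

lemma q_power_less_1: "q * q ^ k < 1"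
  using qpoch_inf_factor_pos[OF q q(2), of k] by simp

text \<open>Consecutive entries have the quotient \<open>(1 - q ^ (k + 1)) / (1 - q powr (k + \<nu>)) \<ge> 1\<close>,
  because \<open>\<nu> < 1\<close>.\<close>

lemma decseq_q_kernel: "decseq (q_kernel q \<nu>)"
proof (rule decseq_SucI)
  fix k
  let ?u = "q * q ^ k" and ?v = "q powr \<nu> * q ^ k"
  have u: "?u < 1" by (rule q_power_less_1)
  have v: "?v < 1" by (rule q_powr_power_less_1)
  have uv: "?u \<le> ?v" using q q_powr_bounds by simp
  have pos: "qpoch_inf (q * ?u) q > 0" "qpoch_inf (q * ?v) q > 0"
    using qpoch_inf_pos[OF q q_power_less_1[of "Suc k"]]
      qpoch_inf_pos[OF q q_powr_power_less_1[of "Suc k"]] by (simp_all add: mult_ac)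
  have "q_kernel q \<nu> k = (1 - ?u) / (1 - ?v) * q_kernel q \<nu> (Suc k)"
    using qpoch_inf_Suc[OF q u] qpoch_inf_Suc[OF q v]
    by (simp add: q_kernel_altdef mult_ac)
  moreover have "(1 - ?u) / (1 - ?v) \<ge> 1"
    using uv v by simp
  moreover have "q_kernel q \<nu> (Suc k) \<ge> 0"
    using pos by (simp add: q_kernel_altdef mult_ac)
  ultimately show "q_kernel q \<nu> (Suc k) \<le> q_kernel q \<nu> k"
    by (metis mult_right_mono mult_1)
qed

lemma q_kernel_tendsto_1: "q_kernel q \<nu> \<longlonglongrightarrow> 1"
  using tendsto_divide[OF qpoch_inf_tendsto_1[OF q q(2)] qpoch_inf_tendsto_1[OF q q_powr_bounds(2)]]
  by (simp add: q_kernel_altdef[abs_def])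

lemma q_Gamma_pos: "q_Gamma q \<nu> > 0"
  using qpoch_inf_pos[OF q q(2)] qpoch_inf_pos[OF q q_powr_bounds(2)] q by (simp add: q_Gamma_def)

end

section \<open>The fractional operators on the lattice\<close>

lemma jackson_integral0_0: "jackson_integral0 q 0 f = 0"
  by (simp add: jackson_integral0_def)

context
  fixes q \<nu> a :: real
  assumes q: "0 < q" "q < 1" and \<nu>: "0 < \<nu>" "\<nu> < 1" and a: "0 < a"
begin

text \<open>The factors \<open>(1 - q) * x\<close> of the Jackson integral and of the q-derivative cancel, and the Caputo
  derivative becomes a series over the increments of \<open>y\<close>.\<close>

lemma q_frac_int_left_deriv_lattice:
  assumes "summable (\<lambda>k. of_real (q_kernel q \<nu> k) * (y (a * q ^ (n + k)) - y (a * q ^ Suc (n + k))))"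
  shows "q_frac_int_left q \<nu> (q_deriv q a y) (a * q ^ n) =
     of_real ((a * q ^ n) powr (\<nu> - 1) / q_Gamma q \<nu>) *
     (\<Sum>k. of_real (q_kernel q \<nu> k) * (y (a * q ^ (n + k)) - y (a * q ^ Suc (n + k))))"
proof -
  let ?x = "a * q ^ n"
  have "(1 - q) *\<^sub>R (\<Sum>k. (?x * q ^ k) *\<^sub>R
       (of_real (qpoch (q * (?x * q ^ k) / ?x) q (\<nu> - 1)) * q_deriv q a y (?x * q ^ k)))
     = (\<Sum>k. of_real (q_kernel q \<nu> k) * (y (a * q ^ (n + k)) - y (a * q ^ Suc (n + k))))"
    (is "_ *\<^sub>R (\<Sum>k. ?t k) = (\<Sum>k. ?u k)")
  proof -
    have "?t k = inverse (1 - q) *\<^sub>R ?u k" for k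
    proof -
      have "q * (?x * q ^ k) / ?x = q ^ Suc k" using q a by simp
      then show ?thesis using q a
        by (simp add: q_kernel_def q_deriv_def q_deriv_quot_def scaleR_conv_of_real power_add field_simps)
    qed
    then have "(\<Sum>k. ?t k) = (\<Sum>k. inverse (1 - q) *\<^sub>R ?u k)" by presburger
    also have "\<dots> = inverse (1 - q) *\<^sub>R (\<Sum>k. ?u k)"
      using assms by (rule suminf_scaleR_right[symmetric])
    finally show ?thesis using q by simp
  qed
  then show ?thesis
    by (simp add: q_frac_int_left_def jackson_integral_def jackson_integral0_0 jackson_integral0_def)
qed

text \<open>Both Jackson integrals in the definition are infinite series, but beyond index \<open>m\<close> the kernel
  vanishes. So the integral from \<open>0\<close> to \<open>q * x\<close> is zero and the one from \<open>0\<close> to \<open>a\<close> is a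
  finite sum, whatever the growth of \<open>f\<close> near \<open>0\<close>.\<close>

lemma q_frac_int_right_lattice:
  "q_frac_int_right q a \<nu> f (a * q ^ m) =
     of_real ((1 - q) / q_Gamma q \<nu>) *
     (\<Sum>n\<le>m. of_real (q_kernel q \<nu> (m - n)) * (of_real ((a * q ^ n) powr \<nu>) * f (a * q ^ n)))"
proof -
  define g :: "real \<Rightarrow> complex"
    where "g t = of_real (t powr (\<nu> - 1) * qpoch (q * (a * q ^ m) / t) q (\<nu> - 1)) * f t" for t
  have van: "g (a * q ^ n) = 0" if "n > m" for n
  proof -
    have "qpoch_inf (q * (a * q ^ m) / (a * q ^ n)) q = 0"
    proof (rule qpoch_inf_eq_0[OF q, of _ "n - Suc m"])
      have "q ^ n = q ^ Suc m * q ^ (n - Suc m)"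
        using that by (simp only: power_add[symmetric]) simp
      then show "q * (a * q ^ m) / (a * q ^ n) * q ^ (n - Suc m) = 1"
        using q a by simp
    qed
    then show ?thesis by (simp add: g_def qpoch_def)
  qed
  have val: "(a * q ^ n) *\<^sub>R g (a * q ^ n) =
      of_real (q_kernel q \<nu> (m - n)) * (of_real ((a * q ^ n) powr \<nu>) * f (a * q ^ n))" if "n \<le> m" for n
  proof -
    have "q ^ m = q ^ n * q ^ (m - n)"
      using that by (simp only: power_add[symmetric]) simp
    then have "q * (a * q ^ m) / (a * q ^ n) = q ^ Suc (m - n)"
      using q a by simp
    moreover have "(a * q ^ n) powr \<nu> = (a * q ^ n) * (a * q ^ n) powr (\<nu> - 1)"
      using q a by (simp add: powr_diff)
    ultimately show ?thesis
      by (simp add: g_def q_kernel_def scaleR_conv_of_real mult_ac)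
  qed
  have lower: "jackson_integral0 q (q * (a * q ^ m)) g = 0"
  proof -
    have "g (q * (a * q ^ m) * q ^ k) = 0" for k
      using van[of "Suc m + k"] by (simp add: power_add mult_ac)
    then show ?thesis by (simp add: jackson_integral0_def)
  qed
  have "(\<Sum>n. (a * q ^ n) *\<^sub>R g (a * q ^ n)) = (\<Sum>n\<le>m. (a * q ^ n) *\<^sub>R g (a * q ^ n))"
    by (rule suminf_finite) (auto simp: van)
  also have "\<dots> = (\<Sum>n\<le>m. of_real (q_kernel q \<nu> (m - n)) * (of_real ((a * q ^ n) powr \<nu>) * f (a * q ^ n)))"
    using val by (intro sum.cong) auto
  finally show ?thesis
    unfolding q_frac_int_right_def g_def[symmetric] jackson_integral_def lower
    by (simp add: jackson_integral0_def scaleR_conv_of_real)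
qed

text \<open>At \<open>0\<close> the factor \<open>qpoch\<close> of the kernel is \<open>1\<close> throughout and nothing is cut off, so the value
  is a genuine infinite series.\<close>

lemma q_frac_int_right_0:
  assumes "summable (\<lambda>n. of_real ((a * q ^ n) powr \<nu>) * f (a * q ^ n))"
  shows "q_frac_int_right q a \<nu> f 0 =
     of_real ((1 - q) / q_Gamma q \<nu>) * (\<Sum>n. of_real ((a * q ^ n) powr \<nu>) * f (a * q ^ n))"
proof -
  have "of_real ((a * q ^ n) powr \<nu>) = of_real (a * q ^ n) * (of_real ((a * q ^ n) powr (\<nu> - 1)) :: complex)" for n
    using q a by (simp add: powr_diff)
  then show ?thesis
    by (simp add: q_frac_int_right_def jackson_integral_def jackson_integral0_0 jackson_integral0_def
        qpoch_0 scaleR_conv_of_real mult_ac)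
qed

text \<open>The range of integration, from \<open>q * (a / q)\<close> to \<open>a\<close>, is empty.\<close>

lemma q_frac_int_right_end: "q_frac_int_right q a \<nu> f (a / q) = 0"
  using q by (simp add: q_frac_int_right_def jackson_integral_def)

lemma q_rl_right_lattice:
  "of_real ((1 - q) * (a * q ^ n)) * q_rl_right q a (1 - \<nu>) f (a * q ^ n) =
     backward_diff (\<lambda>n. q_frac_int_right q a \<nu> f (a * q ^ n)) n"
proof -
  define F where "F = q_frac_int_right q a \<nu> f"
  have "F (1 / q * (a * q ^ n)) = (if n = 0 then 0 else F (a * q ^ (n - 1)))"
    using q_frac_int_right_end[of f] q by (cases n) (auto simp: F_def)
  then have "q_rl_right q a (1 - \<nu>) f (a * q ^ n) =
      of_real (- (1 / q) / ((1 - 1 / q) * (a * q ^ n))) * backward_diff (\<lambda>n. F (a * q ^ n)) n"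
    using q a
    by (simp add: q_rl_right_def q_inv_deriv_def q_deriv_quot_def backward_diff_def F_def)
  moreover have "(1 - q) * (a * q ^ n) * (- (1 / q) / ((1 - 1 / q) * (a * q ^ n))) = 1"
    using q a by (simp add: field_simps)
  ultimately show ?thesis
    by (simp only: F_def mult.assoc[symmetric] of_real_mult[symmetric]) simp
qed

end

section \<open>Duality of the two operators\<close>

text \<open>The discrete form of fractional integration by parts. The backward difference of \<open>G\<close> is the
  convolution of \<open>s\<close> with the backward difference \<open>\<delta>\<close> of \<open>\<kappa>\<close>. Moving \<open>\<delta>\<close> over to \<open>Y\<close> gives
  \<open>\<Sum>k. \<delta> k * Y (n + k)\<close>, and summation by parts turns this into \<open>T n + \<eta>\<close>; the \<open>\<eta>\<close> is the
  boundary term at infinity, which corresponds to the endpoint \<open>0\<close> of the lattice. Working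
  with \<open>\<delta>\<close> rather than \<open>\<kappa>\<close> keeps the double series absolutely convergent although the increments of
  \<open>Y\<close> need not be absolutely summable.\<close>

lemma convolution_duality:
  fixes \<kappa> :: "nat \<Rightarrow> real" and s Y :: "nat \<Rightarrow> complex"
  defines "G \<equiv> (\<lambda>m. \<Sum>n\<le>m. of_real (\<kappa> (m - n)) * s n)"
    and "T \<equiv> (\<lambda>n. \<Sum>k. of_real (\<kappa> k) * (Y (n + k) - Y (Suc (n + k))))"
  assumes dec: "decseq \<kappa>" and lim: "\<kappa> \<longlonglongrightarrow> 1" and Y: "Y \<longlonglongrightarrow> \<eta>"
    and G: "summable (\<lambda>m. norm (backward_diff G m))"
  shows "summable (\<lambda>k. of_real (\<kappa> k) * (Y (n + k) - Y (Suc (n + k))))"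
    and "summable s"
    and "summable (\<lambda>n. s n * T n)"
    and "(\<lambda>m. backward_diff G m * Y m) sums ((\<Sum>n. s n * T n) + (\<Sum>n. s n) * \<eta>)"
proof -
  define \<delta> where "\<delta> = backward_diff (\<lambda>k. complex_of_real (\<kappa> k))"
  have "\<delta> k = of_real (backward_diff \<kappa> k)" for k
    by (simp add: \<delta>_def backward_diff_def)
  then have \<delta>: "summable (\<lambda>k. norm (\<delta> k))"
    using backward_diff_abs_summable[OF dec lim] by simp
  have s: "summable (\<lambda>n. norm (s n))"
    using abs_summable_of_convolution[OF dec lim] G by (simp add: G_def)
  then show s': "summable s" by (rule summable_norm_cancel)
  have Bs: "Bseq Y"
    using Y by (intro convergent_imp_Bseq convergentI)
  have by_parts: "(\<lambda>k. of_real (\<kappa> k) * (Y (n + k) - Y (Suc (n + k)))) sums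
      ((\<Sum>k. \<delta> k * Y (n + k)) - \<eta>)" for n
  proof -
    obtain B where "\<And>k. norm (Y k) \<le> B"
      using Bs by (auto simp: Bseq_def)
    then have "summable (\<lambda>k. \<delta> k * Y (n + k))"
      by (intro summable_comparison_test'[OF summable_mult2[OF \<delta>, of B]])
         (auto simp: norm_mult intro!: mult_left_mono)
    moreover have "(\<lambda>k. complex_of_real (\<kappa> k)) \<longlonglongrightarrow> 1"
      using tendsto_of_real[OF lim] by simp
    moreover have "(\<lambda>k. Y (n + k)) \<longlonglongrightarrow> \<eta>"
      using LIMSEQ_ignore_initial_segment[OF Y, of n] by (simp add: add.commute)
    ultimately show ?thesis
      using summation_by_parts_sums[of "\<lambda>k. of_real (\<kappa> k)" "\<lambda>k. Y (n + k)" 1 \<eta>]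
      by (simp add: \<delta>_def)
  qed
  then show "summable (\<lambda>k. of_real (\<kappa> k) * (Y (n + k) - Y (Suc (n + k))))"
    by (rule sums_summable)
  have T: "(\<Sum>k. \<delta> k * Y (n + k)) = T n + \<eta>" for n
    using by_parts[of n] by (simp add: T_def sums_iff)
  note pairing = convolution_pairing_sums[OF \<delta> s Bs, unfolded T]
  have "summable (\<lambda>n. s n * (T n + \<eta>) - s n * \<eta>)"
    by (intro summable_diff pairing summable_mult2 s')
  then show sT: "summable (\<lambda>n. s n * T n)"
    by (simp add: distrib_left)
  have "(\<Sum>n. s n * (T n + \<eta>)) = (\<Sum>n. s n * T n) + (\<Sum>n. s n) * \<eta>"
    unfolding distrib_left suminf_mult2[OF s']
    by (rule suminf_add[symmetric]) (intro sT summable_mult2 s')+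
  then show "(\<lambda>m. backward_diff G m * Y m) sums ((\<Sum>n. s n * T n) + (\<Sum>n. s n) * \<eta>)"
    using pairing(2)
    by (simp add: G_def \<delta>_def backward_diff_convolution[where \<kappa> = "\<lambda>k. of_real (\<kappa> k)"])
qed

text \<open>A nontrivial real linear relation makes \<open>u\<close> and \<open>v\<close> real multiples of a common complex
  number.\<close>

lemma real_boundary_form:
  fixes c1 c2 :: real and u v :: complex
  assumes "c1\<^sup>2 + c2\<^sup>2 \<noteq> 0" and "of_real c1 * u + of_real c2 * v = 0"
  shows "Im (v * cnj u) = 0"
proof (cases "c2 = 0")
  case True
  with assms show ?thesis by simp
next
  case False
  have "of_real c2 * v = - (of_real c1 * u)"
    using assms(2) by (simp add: add_eq_0_iff2)
  then have "v = of_real (- c1 / c2) * u"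
    using False by (simp add: field_simps)
  then have "v * cnj u = of_real (- c1 / c2 * (cmod u)\<^sup>2)"
    by (simp only: mult.assoc complex_norm_square[symmetric] of_real_mult)
  then show ?thesis
    by (simp only: Im_complex_of_real)
qed

theorem theorem3p3:
  fixes q a \<alpha> c1 c2 d1 d2 :: real
    and p r w :: "real \<Rightarrow> real"
    and ev :: complex
  assumes "0 < q" and "q < 1" and "0 < a" and "0 < \<alpha>" and "\<alpha> < 1"
    and "\<And>x. x \<in> q_lattice0 q a \<Longrightarrow> p x \<noteq> 0"
    and "\<And>x. x \<in> q_lattice0 q a \<Longrightarrow> w x > 0"
    and "c1\<^sup>2 + c2\<^sup>2 \<noteq> 0" and "d1\<^sup>2 + d2\<^sup>2 \<noteq> 0"
    and "q_sl_eigenvalue q a \<alpha> p r w c1 c2 d1 d2 ev"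
  shows "ev \<in> \<real>"
proof (rule ccontr)
  assume "ev \<notin> \<real>"
  then have Im_ev: "Im ev \<noteq> 0" by (simp add: complex_is_Real_iff)
  obtain y where sol: "q_sl_solution q a \<alpha> p r w c1 c2 d1 d2 ev y"
    and nontrivial: "\<exists>x\<in>q_lattice0 q a. y x \<noteq> 0"
    using assms(10) by (auto simp: q_sl_eigenvalue_def)
  note q = \<open>0 < q\<close> \<open>q < 1\<close> and a = \<open>0 < a\<close>
  define \<nu> where "\<nu> = 1 - \<alpha>"
  have \<nu>: "0 < \<nu>" "\<nu> < 1" and \<alpha>: "\<alpha> = 1 - \<nu>"
    using assms(4,5) by (auto simp: \<nu>_def)
  define x where "x n = a * q ^ n" for n
  define Y where "Y n = y (x n)" for n
  define f where "f = q_sl_flux q a \<alpha> p y"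
  define R where "R n = q_rl_right q a \<alpha> f (x n)" for n
  define \<kappa> where "\<kappa> = q_kernel q \<nu>"
  define \<Gamma> where "\<Gamma> = q_Gamma q \<nu>"
  define s where "s n = of_real (x n powr \<nu>) * f (x n)" for n
  define G where "G m = (\<Sum>n\<le>m. of_real (\<kappa> (m - n)) * s n)" for m
  define T where "T n = (\<Sum>k. of_real (\<kappa> k) * (Y (n + k) - Y (Suc (n + k))))" for n
  have x_pos: "x n > 0" for n using q a by (simp add: x_def)
  have x_in: "x n \<in> q_lattice0 q a" for n
    by (auto simp: q_lattice0_def q_lattice_def x_def)
  have \<Gamma>: "\<Gamma> > 0" unfolding \<Gamma>_def by (rule q_Gamma_pos[OF q \<nu>])
  have dec: "decseq \<kappa>" and lim: "\<kappa> \<longlonglongrightarrow> 1"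
    unfolding \<kappa>_def using decseq_q_kernel[OF q \<nu>] q_kernel_tendsto_1[OF q \<nu>] by auto
  have Y: "Y \<longlonglongrightarrow> y 0"
    using sol x_in[of 0]
    by (auto simp: q_sl_solution_def q_regular_at_zero_def Y_def[abs_def] x_def)

  have dG: "backward_diff G n = of_real (\<Gamma> * x n) * R n" for n
  proof -
    have "of_real ((1 - q) * x n) * R n =
        backward_diff (\<lambda>m. of_real ((1 - q) / \<Gamma>) * G m) n"
      using q_rl_right_lattice[OF q \<nu> a, of n f]
      by (simp add: R_def x_def \<alpha> q_frac_int_right_lattice[OF q \<nu> a] G_def[abs_def] s_def \<kappa>_def \<Gamma>_def)
    also have "\<dots> = of_real ((1 - q) / \<Gamma>) * backward_diff G n"
      by (simp add: backward_diff_def algebra_simps)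
    finally have *: "of_real ((1 - q) * x n) * R n = of_real ((1 - q) / \<Gamma>) * backward_diff G n" .
    have "of_real (\<Gamma> * x n) * R n = of_real (\<Gamma> / (1 - q)) * (of_real ((1 - q) * x n) * R n)"
      using q by (simp only: mult.assoc[symmetric] of_real_mult[symmetric]) simp
    also have "\<dots> = backward_diff G n"
      using q \<Gamma> by (simp only: * mult.assoc[symmetric] of_real_mult[symmetric]) simp
    finally show ?thesis by simp
  qed
  have G: "summable (\<lambda>m. norm (backward_diff G m))"
  proof -
    have "convergent R"
      using sol by (simp add: q_sl_solution_def R_def[abs_def] x_def f_def)
    then obtain B where B: "\<And>n. norm (R n) \<le> B"
      using convergent_imp_Bseq[of R] by (auto simp: Bseq_def)
    have geometric: "summable (\<lambda>n. \<Gamma> * a * B * q ^ n)"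
      using q by (intro summable_mult summable_geometric) auto
    have "norm (backward_diff G n) \<le> \<Gamma> * a * B * q ^ n" for n
    proof -
      have "norm (backward_diff G n) = \<Gamma> * x n * norm (R n)"
        using \<Gamma> x_pos[of n] by (simp add: dG norm_mult)
      also have "\<dots> \<le> \<Gamma> * x n * B"
        using \<Gamma> x_pos[of n] B by (intro mult_left_mono) auto
      finally show ?thesis by (simp add: x_def mult_ac)
    qed
    then show ?thesis
      by (intro summable_comparison_test'[OF geometric, of 0]) simp
  qed
  note dual = convolution_duality[OF dec lim Y, of s, folded G_def T_def, OF G]
  have T_cnj: "(\<Sum>k. of_real (\<kappa> k) * (cnj (Y (n + k)) - cnj (Y (Suc (n + k))))) = cnj (T n)" for n
  proof -
    have "(\<lambda>k. cnj (of_real (\<kappa> k) * (Y (n + k) - Y (Suc (n + k))))) sums cnj (T n)"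
      unfolding sums_cnj T_def by (rule summable_sums[OF dual(1)])
    then show ?thesis by (simp add: sums_iff)
  qed
  have "(\<lambda>n. cnj (Y n)) \<longlonglongrightarrow> cnj (y 0)"
    using Y by (rule tendsto_cnj)
  \<comment> \<open>The duality is bilinear; conjugating the second argument makes it the sesquilinear pairing.\<close>
  note dual_cnj = convolution_duality(3,4)[OF dec lim this, of s, folded G_def, OF G, unfolded T_cnj]

  have interior: "Im (\<Sum>n. s n * cnj (T n)) = 0"
  proof -
    have "s n * cnj (T n) = of_real (x n powr \<nu> * p (x n) * (x n powr (\<nu> - 1) / \<Gamma>) * (cmod (T n))\<^sup>2)" for n
    proof -
      have "f (x n) = of_real (p (x n)) * (of_real (x n powr (\<nu> - 1) / \<Gamma>) * T n)"
        using q_frac_int_left_deriv_lattice[OF q \<nu> a, of y n] dual(1)[of n]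
        by (simp add: f_def q_sl_flux_def q_caputo_left_def \<alpha> x_def Y_def[abs_def] T_def \<kappa>_def \<Gamma>_def)
      then show ?thesis
        by (simp only: s_def of_real_mult complex_norm_square mult_ac)
    qed
    then have "Im (s n * cnj (T n)) = 0" for n
      by (simp only: Im_complex_of_real)
    then have "(\<lambda>n. 0) sums Im (\<Sum>n. s n * cnj (T n))"
      using sums_Im[OF summable_sums[OF dual_cnj(1)]] by (simp only:)
    then show ?thesis
      by (rule sums_unique2[OF _ sums_zero])
  qed
  have boundary: "Im ((\<Sum>n. s n) * cnj (y 0)) = 0"
  proof -
    have "q_frac_int_right q a \<nu> f 0 = of_real ((1 - q) / \<Gamma>) * (\<Sum>n. s n)"
      using q_frac_int_right_0[OF q \<nu> a, of f] dual(2)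
      by (simp add: s_def[abs_def] x_def \<Gamma>_def)
    moreover have "Im (q_frac_int_right q a \<nu> f 0 * cnj (y 0)) = 0"
      using sol assms(8) by (intro real_boundary_form) (auto simp: q_sl_solution_def f_def \<nu>_def)
    ultimately have "Im (of_real ((1 - q) / \<Gamma>) * ((\<Sum>n. s n) * cnj (y 0))) = 0"
      by (simp only: mult.assoc)
    then have "(1 - q) / \<Gamma> * Im ((\<Sum>n. s n) * cnj (y 0)) = 0"
      by (simp only: Im_complex_of_real Re_complex_of_real times_complex.sel mult_zero_left add_0_right)
    then show ?thesis using q \<Gamma> by (simp del: times_complex.sel)
  qed

  have eq: "Im (backward_diff G n * cnj (Y n)) = Im ev * (\<Gamma> * x n * w (x n) * (cmod (Y n))\<^sup>2)" for n
  proof -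
    have "R n = (ev * of_real (w (x n)) - of_real (r (x n))) * Y n"
      using sol x_in[of n]
      by (auto simp: q_sl_solution_def f_def R_def Y_def algebra_simps)
    then have "backward_diff G n * cnj (Y n) =
        of_real (\<Gamma> * x n) * ((ev * of_real (w (x n)) - of_real (r (x n))) * of_real ((cmod (Y n))\<^sup>2))"
      unfolding dG complex_norm_square by (simp only: mult.assoc)
    then show ?thesis by simp
  qed
  have "(\<lambda>n. Im ev * (\<Gamma> * x n * w (x n) * (cmod (Y n))\<^sup>2)) sums 0"
    using sums_Im[OF dual_cnj(2)] interior boundary by (simp only: eq plus_complex.sel) simp
  then have sum0: "(\<lambda>n. \<Gamma> * x n * w (x n) * (cmod (Y n))\<^sup>2) sums 0"
    using sums_mult_D[OF _ Im_ev] by fastforce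
  have weight: "\<Gamma> * x n * w (x n) > 0" for n
    using \<Gamma> x_pos[of n] assms(7)[OF x_in[of n]] by simp
  have "Y n = 0" for n
  proof -
    have "\<forall>n. \<Gamma> * x n * w (x n) * (cmod (Y n))\<^sup>2 = 0"
      using sum0 weight by (subst suminf_eq_zero_iff[symmetric]) (auto simp: sums_iff less_imp_le)
    then have "(cmod (Y n))\<^sup>2 = 0"
      using weight[of n] by (metis less_irrefl mult_eq_0_iff)
    then show ?thesis by simp
  qed
  moreover from this have "Y = (\<lambda>n. 0)" by blast
  with Y have "y 0 = 0" by (simp add: LIMSEQ_const_iff)
  ultimately show False
    using nontrivial by (auto simp: q_lattice0_def q_lattice_def Y_def x_def)
qed

end
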